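(* Let $\rho\in\mathbb{N}$, and let $\delta_1,\dots,\delta_\rho\in(-1,+\infty)$ and $\kappa_1,\dots,\kappa_\rho\in\mathbb{Z}_+$ be arbitrary parameters. If $\alpha>-1$, then for all $x\in\mathbb{C}$ and $n\in\mathbb{Z}_+$, $$\mathcal{L}_n(x;\alpha,\delta_1,\dots,\delta_\rho,\kappa_1,\dots,\kappa_\rho)=\frac{n!}{2\pi i}\oint_{|\zeta|=1}\zeta^{-n-1}e^{\zeta}\,{}_{\rho}F_{\rho+1}\left(\delta_1+1,\dots,\delta_\rho+1;\ \alpha+1,\kappa_1+\delta_1+1,\dots,\kappa_\rho+\delta_\rho+1;\ -x\zeta\right)d\zeta.$$ If $\alpha,\beta\in(-1,+\infty)$ with $\alpha+\beta>-1$, then for all $x\in\mathbb{C}$ with $|x|<\frac14$ and all $n\in\mathbb{Z}_+$, $$\mathcal{P}_n(x;\alpha,\beta,\delta_1,\dots,\delta_\rho,\kappa_1,\dots,\kappa_\rho)=\frac{1}{2\pi i}\frac{n!}{(\alpha+\beta+1)_n}\oint_{|\zeta|=\frac14}\zeta^{-n-1}(1-\zeta)^{-\alpha-\beta-1}\,F(\zeta)\,d\zeta,$$ where $$F(\zeta)={}_{\rho+2}F_{\rho+1}\left(\tfrac{\alpha+\beta+1}{2},\tfrac{\alpha+\beta+2}{2},\delta_1+1,\dots,\delta_\rho+1;\ \alpha+1,\kappa_1+\delta_1+1,\dots,\kappa_\rho+\delta_\rho+1;\ -\frac{4x\zeta}{(1-\zeta)^2}\right).$$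
   Context: $\mathbb{N}$ is the set of positive integers, $\mathbb{Z}_+$ the set of non-negative integers. The Pochhammer symbol is $(c)_0=1$, $(c)_k=c(c+1)\cdots(c+k-1)$ for $k\ge1$. The generalized hypergeometric function is $${}_mF_n(a_1,\dots,a_m;b_1,\dots,b_n;x)=\sum_{k=0}^\infty\frac{(a_1)_k\cdots(a_m)_k}{(b_1)_k\cdots(b_n)_k}\frac{x^k}{k!};$$ when an upper parameter is $-n$ with $n\in\mathbb{Z}_+$ it is a polynomial in $x$ (sum over $0\le k\le n$). Powers of $1-\zeta$ are principal branches (equal to $1$ at $\zeta=0$); circles are traversed once counterclockwise. For $n\in\mathbb{Z}_+$, define $$\mathcal{P}_n(x;\alpha,\beta,\delta_1,\dots,\delta_\rho,\kappa_1,\dots,\kappa_\rho)={}_{\rho+2}F_{\rho+1}(-n,n+\alpha+\beta+1,\delta_1+1,\dots,\delta_\rho+1;\alpha+1,\kappa_1+\delta_1+1,\dots,\kappa_\rho+\delta_\rho+1;x),$$ $$\mathcal{L}_n(x;\alpha,\delta_1,\dots,\delta_\rho,\kappa_1,\dots,\kappa_\rho)={}_{\rho+1}F_{\rho+1}(-n,\delta_1+1,\dots,\delta_\rho+1;\alpha+1,\kappa_1+\delta_1+1,\dots,\kappa_\rho+\delta_\rho+1;x).$$ *)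

theory Defs
  imports "HOL-Complex_Analysis.Complex_Analysis"
begin

text \<open>
  The series is meaningful only where it converges and no lower parameter is a non-positive
  integer. If some upper parameter is a non-positive integer, its terms vanish from some index
  on, so that no convergence condition on \<open>x\<close> is needed.
\<close>

definition hypergeom :: "complex list \<Rightarrow> complex list \<Rightarrow> complex \<Rightarrow> complex" where
  "hypergeom as bs x =
     (\<Sum>k. (\<Prod>a\<leftarrow>as. pochhammer a k) / (\<Prod>b\<leftarrow>bs. pochhammer b k) * (x ^ k / fact k))"

text \<open>
  The parameters \<open>\<delta>\<^sub>1, \<dots>, \<delta>\<^sub>\<rho>\<close> and \<open>\<kappa>\<^sub>1, \<dots>, \<kappa>\<^sub>\<rho>\<close> are given as two lists of the
  same length \<open>\<rho>\<close>. The following are the parameters \<open>\<delta>\<^sub>j + 1\<close> and \<open>\<kappa>\<^sub>j + \<delta>\<^sub>j + 1\<close>.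
\<close>

definition upper_params :: "real list \<Rightarrow> complex list" where
  "upper_params \<delta>s = map (\<lambda>\<delta>. of_real (\<delta> + 1)) \<delta>s"

definition lower_params :: "real list \<Rightarrow> nat list \<Rightarrow> complex list" where
  "lower_params \<delta>s \<kappa>s = map2 (\<lambda>\<kappa> \<delta>. of_real (real \<kappa> + \<delta> + 1)) \<kappa>s \<delta>s"

definition poly_P ::
    "nat \<Rightarrow> complex \<Rightarrow> real \<Rightarrow> real \<Rightarrow> real list \<Rightarrow> nat list \<Rightarrow> complex" where
  "poly_P n x \<alpha> \<beta> \<delta>s \<kappa>s =
     hypergeom (- of_nat n # of_real (real n + \<alpha> + \<beta> + 1) # upper_params \<delta>s)
               (of_real (\<alpha> + 1) # lower_params \<delta>s \<kappa>s) x"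

definition poly_L ::
    "nat \<Rightarrow> complex \<Rightarrow> real \<Rightarrow> real list \<Rightarrow> nat list \<Rightarrow> complex" where
  "poly_L n x \<alpha> \<delta>s \<kappa>s =
     hypergeom (- of_nat n # upper_params \<delta>s)
               (of_real (\<alpha> + 1) # lower_params \<delta>s \<kappa>s) x"

end

theory Submission
  imports Defs "HOL-Real_Asymp.Real_Asymp"
begin

text \<open>
  Expand the hypergeometric function in the integrand and integrate term by term; this is
  legitimate because each ratio \<open>(\<delta>\<^sub>j + 1)\<^sub>k / (\<kappa>\<^sub>j + \<delta>\<^sub>j + 1)\<^sub>k\<close> is at most 1, and
  \<open>|4 x \<zeta> / (1 - \<zeta>)\<^sup>2| < 4 / 9\<close> on the circle of radius \<open>1 / 4\<close>. Cauchy's formula picks out the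
  Taylor coefficient of order \<open>n - k\<close> at 0 of \<open>e\<^sup>\<zeta>\<close>, which is \<open>1 / (n - k)!\<close>, or of
  \<open>(1 - \<zeta>)\<close> to the power \<open>- c - 2 k\<close> with \<open>c = \<alpha> + \<beta> + 1\<close>, which is
  \<open>(c + 2 k)\<^sub>n\<^sub>-\<^sub>k / (n - k)!\<close>. The duplication formula \<open>4\<^sup>k (c / 2)\<^sub>k ((c + 1) / 2)\<^sub>k = (c)\<^sub>2\<^sub>k\<close> and
  \<open>(c)\<^sub>2\<^sub>k (c + 2 k)\<^sub>n\<^sub>-\<^sub>k = (c)\<^sub>n (c + n)\<^sub>k\<close> then give the coefficients of the polynomial.
\<close>

section \<open>Termwise integration and coefficient extraction on circles around 0\<close>

text \<open>The Weierstrass M-test gives uniform convergence on the circle, so sum and integral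
  commute. The weight \<open>W\<close> is bounded on the compact circle, so only the factors
  \<open>T k\<close> need a summable majorant.\<close>

lemma contour_integral_circlepath_series:
  fixes T :: "nat \<Rightarrow> complex \<Rightarrow> complex"
  assumes r: "0 < r" and M: "summable M"
    and TM: "\<And>k \<zeta>. norm \<zeta> = r \<Longrightarrow> norm (T k \<zeta>) \<le> M k"
    and W: "continuous_on (sphere 0 r) W"
    and I: "\<And>k. ((\<lambda>\<zeta>. W \<zeta> * T k \<zeta>) has_contour_integral I k) (circlepath 0 r)"
  shows "I sums contour_integral (circlepath 0 r) (\<lambda>\<zeta>. W \<zeta> * (\<Sum>k. T k \<zeta>))"
proof -
  obtain B where B: "norm (W \<zeta>) \<le> B" if "norm \<zeta> = r" for \<zeta>
    using compact_imp_bounded[OF compact_continuous_image[OF W compact_sphere]]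
    by (force simp: bounded_iff)
  \<comment> \<open>The point \<open>r\<close> lies on the circle, so \<open>B\<close> dominates the
    norm of an actual value.\<close>
  have B0: "0 \<le> B"
    using B[of "of_real r"] r by (simp add: order_trans[OF norm_ge_zero])
  have sT: "summable (\<lambda>k. T k \<zeta>)" if "norm \<zeta> = r" for \<zeta>
    by (rule summable_comparison_test'[OF M, of 0]) (use TM that in auto)
  have "uniform_limit (sphere 0 r) (\<lambda>m \<zeta>. \<Sum>k<m. W \<zeta> * T k \<zeta>)
          (\<lambda>\<zeta>. \<Sum>k. W \<zeta> * T k \<zeta>) sequentially"
    by (rule Weierstrass_m_test[where M = "\<lambda>k. B * M k"])
       (auto simp: norm_mult intro!: mult_mono TM B B0 summable_mult M)
  also have "?this \<longleftrightarrow> uniform_limit (sphere 0 r) (\<lambda>m \<zeta>. \<Sum>k<m. W \<zeta> * T k \<zeta>)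
          (\<lambda>\<zeta>. W \<zeta> * (\<Sum>k. T k \<zeta>)) sequentially"
    by (rule uniform_limit_cong') (auto simp: suminf_mult sT)
  finally have lim: "uniform_limit (sphere 0 r) (\<lambda>m \<zeta>. \<Sum>k<m. W \<zeta> * T k \<zeta>)
          (\<lambda>\<zeta>. W \<zeta> * (\<Sum>k. T k \<zeta>)) sequentially" .
  have int: "((\<lambda>\<zeta>. \<Sum>k<m. W \<zeta> * T k \<zeta>) has_contour_integral (\<Sum>k<m. I k)) (circlepath 0 r)" for m
    by (intro has_contour_integral_sum I) auto
  have "(\<lambda>m. contour_integral (circlepath 0 r) (\<lambda>\<zeta>. \<Sum>k<m. W \<zeta> * T k \<zeta>)) \<longlonglongrightarrow>
      contour_integral (circlepath 0 r) (\<lambda>\<zeta>. W \<zeta> * (\<Sum>k. T k \<zeta>))"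
    by (rule contour_integral_uniform_limit_circlepath[OF _ lim])
       (use r in \<open>auto intro!: always_eventually has_contour_integral_integrable[OF int]\<close>)
  then show ?thesis
    by (simp add: sums_def contour_integral_unique[OF int])
qed

text \<open>For \<open>k \<le> n\<close> this is Cauchy's formula for the derivative of order
  \<open>n - k\<close>. For larger \<open>k\<close> the pole at 0 is cancelled, which will match the
  vanishing of \<open>pochhammer (- of_nat n) k\<close>.\<close>

lemma has_contour_integral_circlepath_coeff:
  assumes h: "h holomorphic_on ball 0 R" and r: "0 < r" "r < R"
  shows "((\<lambda>\<zeta>. \<zeta> powi (- int n - 1) * (\<zeta> ^ k * h \<zeta>)) has_contour_integral
           (if k \<le> n then 2 * of_real pi * \<i> / fact (n - k) * (deriv ^^ (n - k)) h 0 else 0))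
         (circlepath 0 r)"
proof (cases "k \<le> n")
  case True
  have hc: "h holomorphic_on cball 0 r"
    by (rule holomorphic_on_subset[OF h]) (use r in auto)
  have "((\<lambda>\<zeta>. h \<zeta> / (\<zeta> - 0) ^ Suc (n - k)) has_contour_integral
      of_real (2 * pi) * \<i> / fact (n - k) * (deriv ^^ (n - k)) h 0) (circlepath 0 r)"
    by (rule Cauchy_has_contour_integral_higher_derivative_circlepath)
       (use r in \<open>auto intro: holomorphic_on_imp_continuous_on hc holomorphic_on_subset[OF hc]\<close>)
  moreover have "h \<zeta> / (\<zeta> - 0) ^ Suc (n - k) = \<zeta> powi (- int n - 1) * (\<zeta> ^ k * h \<zeta>)"
    if "\<zeta> \<in> path_image (circlepath 0 r)" for \<zeta>
  proof -
    have z: "\<zeta> \<noteq> 0" using that r by auto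
    have "\<zeta> powi (- int n - 1) * \<zeta> ^ k = \<zeta> powi (- int n - 1 + int k)"
      using z by (simp add: power_int_add)
    also have "- int n - 1 + int k = - int (Suc (n - k))" using True by simp
    also have "\<zeta> powi \<dots> = inverse (\<zeta> ^ Suc (n - k))"
      by (simp only: power_int_minus power_int_of_nat)
    finally show ?thesis by (simp add: field_simps)
  qed
  ultimately have "((\<lambda>\<zeta>. \<zeta> powi (- int n - 1) * (\<zeta> ^ k * h \<zeta>)) has_contour_integral
      of_real (2 * pi) * \<i> / fact (n - k) * (deriv ^^ (n - k)) h 0) (circlepath 0 r)"
    by (rule has_contour_integral_eq)
  then show ?thesis
    using True by simp
next
  case False
  \<comment> \<open>Since \<open>n < k\<close>, the truncated subtraction is exact; a natural power
    leaves the function holomorphic at 0 too.\<close>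
  have "((\<lambda>\<zeta>. \<zeta> ^ (k - n - 1) * h \<zeta>) has_contour_integral 0) (circlepath 0 r)"
    by (rule Cauchy_theorem_convex_simple[of _ "ball 0 R"])
       (use r in \<open>auto intro!: holomorphic_intros h\<close>)
  moreover have "\<zeta> ^ (k - n - 1) * h \<zeta> = \<zeta> powi (- int n - 1) * (\<zeta> ^ k * h \<zeta>)"
    if "\<zeta> \<in> path_image (circlepath 0 r)" for \<zeta>
  proof -
    have z: "\<zeta> \<noteq> 0" using that r by auto
    have "\<zeta> powi (- int n - 1) * \<zeta> ^ k = \<zeta> powi (- int n - 1 + int k)"
      using z by (simp add: power_int_add)
    also have "- int n - 1 + int k = int (k - n - 1)" using False by simp
    finally show ?thesis by simp
  qed
  ultimately have "((\<lambda>\<zeta>. \<zeta> powi (- int n - 1) * (\<zeta> ^ k * h \<zeta>)) has_contour_integral 0)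
      (circlepath 0 r)"
    by (rule has_contour_integral_eq)
  then show ?thesis
    using False by simp
qed

section \<open>Taylor coefficients of the two kernels\<close>

lemma higher_deriv_exp: "(deriv ^^ m) exp = (exp :: complex \<Rightarrow> complex)"
proof (induction m)
  case (Suc m)
  have "deriv exp = (exp :: complex \<Rightarrow> complex)"
    by (rule ext) (rule DERIV_imp_deriv[OF DERIV_exp])
  then show ?case using Suc by simp
qed auto

text \<open>The real part of \<open>1 - z\<close> is positive, so the principal power stays off its
  branch cut.\<close>

lemma one_minus_not_nonpos_Reals:
  fixes z :: complex
  shows "norm z < 1 \<Longrightarrow> 1 - z \<notin> \<real>\<^sub>\<le>\<^sub>0"
  using abs_Re_le_cmod[of z] by (auto simp: complex_nonpos_Reals_iff)

lemma holomorphic_one_minus_powr: "(\<lambda>z. (1 - z) powr s) holomorphic_on ball 0 1"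
  by (intro holomorphic_intros) (auto dest: one_minus_not_nonpos_Reals)

text \<open>The minus signs from the exponent and from the inner function \<open>1 - z\<close>
  cancel, so each derivative contributes the factor \<open>b + m\<close>. A general \<open>z\<close>
  is needed for the induction, although only 0 is used later.\<close>

lemma higher_deriv_one_minus_powr:
  fixes z :: complex
  assumes "norm z < 1"
  shows "(deriv ^^ m) (\<lambda>z. (1 - z) powr (- b)) z = pochhammer b m * (1 - z) powr (- b - of_nat m)"
  using assms
proof (induction m arbitrary: z)
  case (Suc m)
  \<comment> \<open>Differentiating the induction hypothesis requires it on a whole neighbourhood of
    \<open>z\<close>.\<close>
  have ev: "eventually (\<lambda>w. (deriv ^^ m) (\<lambda>z. (1 - z) powr (- b)) w =
              pochhammer b m * (1 - w) powr (- b - of_nat m)) (nhds z)"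
    using Suc by (intro eventually_nhds_in_open[THEN eventually_mono, of "ball 0 1"]) auto
  have "((\<lambda>w. pochhammer b m * (1 - w) powr (- b - of_nat m)) has_field_derivative
          pochhammer b m * ((- b - of_nat m) * (1 - z) powr (- b - of_nat m - 1) * (- 1))) (at z)"
    by (rule DERIV_cmult, rule DERIV_chain2[OF has_field_derivative_powr])
       (use Suc.prems in \<open>auto intro!: derivative_eq_intros dest: one_minus_not_nonpos_Reals\<close>)
  then have "deriv (\<lambda>w. pochhammer b m * (1 - w) powr (- b - of_nat m)) z =
      pochhammer b (Suc m) * (1 - z) powr (- b - of_nat (Suc m))"
    by (subst DERIV_imp_deriv) (auto simp: pochhammer_Suc algebra_simps)
  then show ?case
    by (simp add: deriv_cong_ev[OF ev refl])
qed auto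

section \<open>Pochhammer estimates and a ratio test\<close>

lemma pochhammer_minus_of_nat:
  assumes "k \<le> n"
  shows "pochhammer (- of_nat n) k = (- 1) ^ k * fact n / (fact (n - k) :: 'a :: field_char_0)"
proof -
  have "(fact n :: 'a) = fact (n - k) * pochhammer (of_nat n - of_nat k + 1) k"
    using assms pochhammer_product[of "n - k" n "1 :: 'a"]
    by (simp add: pochhammer_fact of_nat_diff add_ac)
  then show ?thesis by (simp add: pochhammer_minus)
qed

text \<open>Factor by factor, \<open>0 < \<delta> + 1 + i \<le> \<kappa> + \<delta> + 1 + i\<close>.
  The majorants below therefore do not depend on these parameters.\<close>

lemma norm_param_ratio_le_1:
  assumes "length \<delta>s = length \<kappa>s" "\<forall>\<delta>\<in>set \<delta>s. \<delta> > -1"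
  shows "norm ((\<Prod>a\<leftarrow>upper_params \<delta>s. pochhammer a k) /
               (\<Prod>b\<leftarrow>lower_params \<delta>s \<kappa>s. pochhammer b k)) \<le> 1"
  using assms
proof (induction \<delta>s \<kappa>s rule: list_induct2)
  case (Cons \<delta> \<delta>s \<kappa> \<kappa>s)
  define u l where "u = (\<Prod>a\<leftarrow>upper_params \<delta>s. pochhammer a k)"
    and "l = (\<Prod>b\<leftarrow>lower_params \<delta>s \<kappa>s. pochhammer b k)"
  have 1: "norm (u / l) \<le> 1" using Cons by (simp add: u_def l_def)
  have pos: "0 < pochhammer (\<delta> + 1) k" "0 < pochhammer (real \<kappa> + \<delta> + 1) k"
    using Cons.prems by (auto intro!: pochhammer_pos)
  have "pochhammer (\<delta> + 1) k \<le> pochhammer (real \<kappa> + \<delta> + 1) k"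
    unfolding pochhammer_prod using Cons.prems by (intro prod_mono) auto
  then have 2: "norm (complex_of_real (pochhammer (\<delta> + 1) k / pochhammer (real \<kappa> + \<delta> + 1) k)) \<le> 1"
    using pos by (simp add: divide_simps norm_divide)
  have "norm (complex_of_real (pochhammer (\<delta> + 1) k / pochhammer (real \<kappa> + \<delta> + 1) k) * (u / l)) \<le> 1"
    unfolding norm_mult using mult_mono[OF 2 1] by simp
  then show ?case
    unfolding upper_params_def lower_params_def u_def l_def
    by (simp only: zip_Cons_Cons list.map prod.case prod_list.Cons pochhammer_of_real
        of_real_divide times_divide_times_eq)
qed (simp add: upper_params_def lower_params_def)

text \<open>Beyond some index the ratios stay below a constant strictly between \<open>L\<close> and
  1. The recurrence form admits zero terms, which occur for \<open>x = 0\<close>.\<close>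

lemma summable_ratio_limit:
  fixes f q :: "nat \<Rightarrow> real"
  assumes q: "q \<longlonglongrightarrow> L" "L < 1" and f: "\<And>k. 0 \<le> f k" "\<And>k. f (Suc k) = q k * f k"
  shows "summable f"
proof -
  obtain c where c: "L < c" "c < 1" using q(2) dense by blast
  obtain N where "\<And>k. k \<ge> N \<Longrightarrow> q k < c"
    using order_tendstoD(2)[OF q(1) c(1)] by (auto simp: eventually_sequentially)
  then have "norm (f (Suc k)) \<le> c * norm (f k)" if "k \<ge> N" for k
    using that mult_right_mono[OF less_imp_le f(1)] f(1)[of k] f(1)[of "Suc k"] by (simp add: f(2))
  then show ?thesis
    by (rule summable_ratio_test[OF c(2)])
qed

section \<open>The two integral representations\<close>

lemma poly_L_contour_integral:
  assumes len: "length \<delta>s = length \<kappa>s" and \<delta>: "\<forall>\<delta>\<in>set \<delta>s. \<delta> > -1" and \<alpha>: "\<alpha> > -1"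
  shows "poly_L n x \<alpha> \<delta>s \<kappa>s =
           fact n / (2 * of_real pi * \<i>) *
           contour_integral (circlepath 0 1)
             (\<lambda>\<zeta>. \<zeta> powi (- int n - 1) * exp \<zeta> *
                hypergeom (upper_params \<delta>s) (of_real (\<alpha> + 1) # lower_params \<delta>s \<kappa>s) (- x * \<zeta>))"
proof -
  define C :: "nat \<Rightarrow> complex" where "C k = (\<Prod>a\<leftarrow>upper_params \<delta>s. pochhammer a k) /
    (\<Prod>b\<leftarrow>lower_params \<delta>s \<kappa>s. pochhammer b k)" for k
  have C: "norm (C k) \<le> 1" for k
    unfolding C_def by (rule norm_param_ratio_le_1[OF len \<delta>])
  define D :: "nat \<Rightarrow> complex" where "D k = C k / (of_real (pochhammer (\<alpha> + 1) k) * fact k)" for k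
  define T where "T k \<zeta> = D k * (- x * \<zeta>) ^ k" for k \<zeta>
  \<comment> \<open>On the unit circle \<open>x * \<zeta>\<close> has norm \<open>norm x\<close>.
    The ratio of consecutive terms tends to 0, so every \<open>x\<close> is allowed.\<close>
  define M where "M k = norm x ^ k / (pochhammer (\<alpha> + 1) k * fact k)" for k
  define I where "I k = D k * (- x) ^ k *
    (if k \<le> n then 2 * of_real pi * \<i> / fact (n - k) else 0)" for k
  have pos: "0 < pochhammer (\<alpha> + 1) k" for k
    using \<alpha> by (intro pochhammer_pos) auto
  have H: "hypergeom (upper_params \<delta>s) (of_real (\<alpha> + 1) # lower_params \<delta>s \<kappa>s) (- x * \<zeta>) =
      (\<Sum>k. T k \<zeta>)" for \<zeta>
    unfolding hypergeom_def T_def D_def C_def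
    by (simp only: list.map prod_list.Cons pochhammer_of_real) (simp add: mult_ac)
  have "I sums contour_integral (circlepath 0 1)
          (\<lambda>\<zeta>. (\<zeta> powi (- int n - 1) * exp \<zeta>) * (\<Sum>k. T k \<zeta>))"
  proof (rule contour_integral_circlepath_series)
    show "summable M"
    proof (rule summable_ratio_limit)
      show "(\<lambda>k. norm x / ((\<alpha> + 1 + real k) * (real k + 1))) \<longlonglongrightarrow> 0"
        by real_asymp
      show "M (Suc k) = norm x / ((\<alpha> + 1 + real k) * (real k + 1)) * M k" for k
        by (simp add: M_def pochhammer_Suc add_ac mult_ac)
    qed (use pos in \<open>auto simp: M_def intro!: divide_nonneg_nonneg mult_nonneg_nonneg less_imp_le[OF pos]\<close>)
    show "norm (T k \<zeta>) \<le> M k" if "norm \<zeta> = 1" for k \<zeta>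
      using mult_right_mono[OF C, of "M k" k] pos[of k] that
      by (simp add: T_def D_def M_def norm_mult norm_divide norm_power)
    show "continuous_on (sphere 0 1) (\<lambda>\<zeta>::complex. \<zeta> powi (- int n - 1) * exp \<zeta>)"
      by (auto intro!: continuous_intros)
    have "T k \<zeta> = D k * (- x) ^ k * \<zeta> ^ k" for k \<zeta>
      by (simp only: T_def power_mult_distrib mult.assoc)
    then show "((\<lambda>\<zeta>. (\<zeta> powi (- int n - 1) * exp \<zeta>) * T k \<zeta>) has_contour_integral I k)
            (circlepath 0 1)" for k
      \<comment> \<open>The radius 2 is an arbitrary choice above 1, as \<open>exp\<close> is
        entire; all its derivatives at 0 equal 1.\<close>
      using has_contour_integral_lmul[OF
          has_contour_integral_circlepath_coeff[of exp 2 1 n k], of "D k * (- x) ^ k"]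
      by (simp add: I_def higher_deriv_exp holomorphic_on_exp mult_ac
          if_distrib cong: if_cong)
  qed auto
  then have sums: "(\<lambda>k. fact n / (2 * of_real pi * \<i>) * I k) sums
      (fact n / (2 * of_real pi * \<i>) * contour_integral (circlepath 0 1)
          (\<lambda>\<zeta>. (\<zeta> powi (- int n - 1) * exp \<zeta>) * (\<Sum>k. T k \<zeta>)))"
    by (rule sums_mult)
  \<comment> \<open>For \<open>k > n\<close> both sides vanish, the right one because the Pochhammer
    symbol contains the factor 0.\<close>
  have term_eq: "fact n / (2 * of_real pi * \<i>) * I k = pochhammer (- of_nat n) k * D k * x ^ k" for k
  proof (cases "k \<le> n")
    case True
    \<comment> \<open>As an opaque nonzero constant, \<open>w\<close> simply cancels.\<close>
    define w where "w = 2 * of_real pi * \<i>"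
    have "w \<noteq> 0" by (simp add: w_def)
    then show ?thesis
      unfolding I_def w_def[symmetric]
      using True by (simp add: pochhammer_minus_of_nat power_minus[of x])
  qed (simp add: I_def pochhammer_of_nat_eq_0_lemma)
  have "poly_L n x \<alpha> \<delta>s \<kappa>s = (\<Sum>k. pochhammer (- of_nat n) k * D k * x ^ k)"
    unfolding poly_L_def hypergeom_def D_def C_def
    by (simp only: list.map prod_list.Cons pochhammer_of_real) (simp add: mult_ac)
  then show ?thesis
    using sums_unique[OF sums] by (simp only: term_eq H)
qed

lemma poly_P_contour_integral:
  assumes len: "length \<delta>s = length \<kappa>s" and \<delta>: "\<forall>\<delta>\<in>set \<delta>s. \<delta> > -1"
    and \<alpha>: "\<alpha> > -1" and \<alpha>\<beta>: "\<alpha> + \<beta> > -1" and x: "norm x < 1 / 4"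
  shows "poly_P n x \<alpha> \<beta> \<delta>s \<kappa>s =
           1 / (2 * of_real pi * \<i>) * (fact n / pochhammer (of_real (\<alpha> + \<beta> + 1)) n) *
           contour_integral (circlepath 0 (1 / 4))
             (\<lambda>\<zeta>. \<zeta> powi (- int n - 1) * (1 - \<zeta>) powr of_real (- \<alpha> - \<beta> - 1) *
                hypergeom
                  (of_real ((\<alpha> + \<beta> + 1) / 2) # of_real ((\<alpha> + \<beta> + 2) / 2) # upper_params \<delta>s)
                  (of_real (\<alpha> + 1) # lower_params \<delta>s \<kappa>s)
                  (- (4 * x * \<zeta> / (1 - \<zeta>)\<^sup>2)))"
proof -
  define c where "c = \<alpha> + \<beta> + 1"
  \<comment> \<open>Positivity makes \<open>E k\<close> positive and the prefactor's denominator
    \<open>pochhammer c n\<close> nonzero.\<close>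
  have c: "0 < c" using \<alpha>\<beta> by (simp add: c_def)
  define C :: "nat \<Rightarrow> complex" where "C k = (\<Prod>a\<leftarrow>upper_params \<delta>s. pochhammer a k) /
    (\<Prod>b\<leftarrow>lower_params \<delta>s \<kappa>s. pochhammer b k)" for k
  have C: "norm (C k) \<le> 1" for k
    unfolding C_def by (rule norm_param_ratio_le_1[OF len \<delta>])
  define D :: "nat \<Rightarrow> complex" where "D k = C k / (of_real (pochhammer (\<alpha> + 1) k) * fact k)" for k
  define E where "E k = pochhammer (c / 2) k * pochhammer ((c + 1) / 2) k" for k
  define T where "T k \<zeta> = of_real (E k) * D k * (- (4 * x * \<zeta> / (1 - \<zeta>)\<^sup>2)) ^ k" for k \<zeta>
  \<comment> \<open>The base comes from \<open>4 * (1/4) * (1/4) / (3/4)^2 = 4/9\<close>. The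
    remaining factors have consecutive ratios tending to 1.\<close>
  define M where "M k = E k / (pochhammer (\<alpha> + 1) k * fact k) * (4 / 9) ^ k" for k
  \<comment> \<open>The factor \<open>(1 - \<zeta>)\<close> to the power \<open>- 2 * k\<close> from
    \<open>T k\<close> merges with the kernel, shifting its exponent to
    \<open>- (c + 2 * k)\<close>.\<close>
  define I where "I k = of_real (E k) * D k * (- 4 * x) ^ k *
    (if k \<le> n then 2 * of_real pi * \<i> / fact (n - k) * pochhammer (of_real c + 2 * of_nat k) (n - k)
     else 0)" for k
  have pos: "0 < pochhammer (\<alpha> + 1) k" for k
    using \<alpha> by (intro pochhammer_pos) auto
  have E: "0 < E k" for k
    unfolding E_def using c by (intro mult_pos_pos pochhammer_pos) auto
  have H: "hypergeom (of_real (c / 2) # of_real ((c + 1) / 2) # upper_params \<delta>s)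
      (of_real (\<alpha> + 1) # lower_params \<delta>s \<kappa>s) z = (\<Sum>k. of_real (E k) * D k * z ^ k)" for z
    unfolding hypergeom_def D_def C_def E_def
    by (simp only: list.map prod_list.Cons pochhammer_of_real of_real_mult) (simp add: mult_ac)
  have "I sums contour_integral (circlepath 0 (1 / 4))
          (\<lambda>\<zeta>. (\<zeta> powi (- int n - 1) * (1 - \<zeta>) powr of_real (- c)) * (\<Sum>k. T k \<zeta>))"
  proof (rule contour_integral_circlepath_series)
    show "summable M"
    proof (rule summable_ratio_limit)
      show "(\<lambda>k. (c / 2 + real k) * ((c + 1) / 2 + real k) / ((\<alpha> + 1 + real k) * (real k + 1)) * (4 / 9))
              \<longlonglongrightarrow> 4 / 9"
        by real_asymp
      show "M (Suc k) = (c / 2 + real k) * ((c + 1) / 2 + real k) /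
              ((\<alpha> + 1 + real k) * (real k + 1)) * (4 / 9) * M k" for k
        by (simp add: M_def E_def pochhammer_Suc add_ac mult_ac)
      show "0 \<le> M k" for k
        using pos[of k] E[of k] by (simp add: M_def)
    qed auto
    show "norm (T k \<zeta>) \<le> M k" if "norm \<zeta> = 1 / 4" for k \<zeta>
    proof -
      \<comment> \<open>The circle of radius \<open>1 / 4\<close> keeps this distance from the
        singularity at 1.\<close>
      have "3 / 4 \<le> norm (1 - \<zeta>)"
        using norm_triangle_ineq2[of 1 \<zeta>] that by simp
      then have "(3 / 4)\<^sup>2 \<le> norm (1 - \<zeta>) ^ 2"
        by (rule power_mono) auto
      then have "norm (- (4 * x * \<zeta> / (1 - \<zeta>)\<^sup>2)) \<le> 1 / 4 / (3 / 4)\<^sup>2"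
        using that x by (simp only: norm_minus_cancel norm_divide norm_mult norm_power)
          (intro frac_le, auto)
      then have 1: "norm (- (4 * x * \<zeta> / (1 - \<zeta>)\<^sup>2)) ^ k \<le> (4 / 9) ^ k"
        by (intro power_mono) (auto simp: power2_eq_square)
      have 2: "norm (of_real (E k) * D k) \<le> E k / (pochhammer (\<alpha> + 1) k * fact k)"
        using mult_right_mono[OF C, of "E k / (pochhammer (\<alpha> + 1) k * fact k)" k] pos[of k] E[of k]
        by (simp add: D_def norm_mult norm_divide mult_ac)
      show ?thesis
        unfolding T_def M_def norm_mult[of "of_real (E k) * D k"] norm_power
        by (rule mult_mono[OF 2 1]) (use pos[of k] E[of k] in auto)
    qed
    have "continuous_on (sphere 0 (1 / 4)) (\<lambda>\<zeta>. (1 - \<zeta>) powr complex_of_real (- c))"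
      by (rule continuous_on_subset[OF
            holomorphic_on_imp_continuous_on[OF holomorphic_one_minus_powr]]) auto
    then show "continuous_on (sphere 0 (1 / 4))
        (\<lambda>\<zeta>. \<zeta> powi (- int n - 1) * (1 - \<zeta>) powr complex_of_real (- c))"
      by (intro continuous_on_mult) (auto intro!: continuous_intros)
    show "((\<lambda>\<zeta>. (\<zeta> powi (- int n - 1) * (1 - \<zeta>) powr of_real (- c)) * T k \<zeta>)
            has_contour_integral I k) (circlepath 0 (1 / 4))" for k
    proof (rule has_contour_integral_eq)
      let ?h = "\<lambda>\<zeta>. (1 - \<zeta>) powr (- (of_real c + 2 * of_nat k)) :: complex"
      have hd: "(deriv ^^ (n - k)) ?h 0 = pochhammer (of_real c + 2 * of_nat k) (n - k)"
        by (subst higher_deriv_one_minus_powr) auto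
      show "((\<lambda>\<zeta>. of_real (E k) * D k * (- 4 * x) ^ k *
               (\<zeta> powi (- int n - 1) * (\<zeta> ^ k * ?h \<zeta>)))
             has_contour_integral I k) (circlepath 0 (1 / 4))"
        unfolding I_def hd[symmetric]
        by (intro has_contour_integral_lmul
            has_contour_integral_circlepath_coeff[OF holomorphic_one_minus_powr]) auto
      fix \<zeta> assume "\<zeta> \<in> path_image (circlepath 0 (1 / 4 :: real))"
      then have "1 - \<zeta> \<noteq> 0" by auto
      \<comment> \<open>For a nonzero base and the natural exponent \<open>2 * k\<close>, the
        principal power is the ordinary one.\<close>
      then have "?h \<zeta> = (1 - \<zeta>) powr (- of_real c) / ((1 - \<zeta>)\<^sup>2) ^ k"
        using powr_nat'[of "1 - \<zeta>" "2 * k"]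
        by (simp add: powr_diff power_mult)
      moreover have "- (4 * x * \<zeta> / (1 - \<zeta>)\<^sup>2) = - 4 * x * \<zeta> / (1 - \<zeta>)\<^sup>2"
        by simp
      then have "T k \<zeta> = of_real (E k) * D k * ((- 4 * x) ^ k * \<zeta> ^ k / ((1 - \<zeta>)\<^sup>2) ^ k)"
        by (simp only: T_def power_mult_distrib power_divide)
      ultimately show "of_real (E k) * D k * (- 4 * x) ^ k * (\<zeta> powi (- int n - 1) * (\<zeta> ^ k * ?h \<zeta>)) =
          (\<zeta> powi (- int n - 1) * (1 - \<zeta>) powr of_real (- c)) * T k \<zeta>"
        by simp
    qed
  qed auto
  then have sums: "(\<lambda>k. 1 / (2 * of_real pi * \<i>) * (fact n / pochhammer (of_real c) n) * I k) sums
      (1 / (2 * of_real pi * \<i>) * (fact n / pochhammer (of_real c) n) *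
       contour_integral (circlepath 0 (1 / 4))
          (\<lambda>\<zeta>. (\<zeta> powi (- int n - 1) * (1 - \<zeta>) powr of_real (- c)) * (\<Sum>k. T k \<zeta>)))"
    by (rule sums_mult)
  have term_eq: "1 / (2 * of_real pi * \<i>) * (fact n / pochhammer (of_real c) n) * I k =
      pochhammer (- of_nat n) k * pochhammer (of_real (c + real n)) k * D k * x ^ k" for k
  proof (cases "k \<le> n")
    case True
    define p where "p = pochhammer (c + 2 * real k) (n - k)"
    have pn: "0 < pochhammer c n" using c by (rule pochhammer_pos)
    have "4 ^ k * E k = pochhammer c (2 * k)"
      using pochhammer_double[of "c / 2" k] by (simp add: E_def add_divide_distrib power_mult)
    \<comment> \<open>The same symbol of length \<open>n + k\<close> is split after
      \<open>2 * k\<close> factors, possible since \<open>k \<le> n\<close>, and then after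
      \<open>n\<close> factors.\<close>
    moreover have "pochhammer c (2 * k) * p = pochhammer c (n + k)"
      using pochhammer_product[of "2 * k" "n + k" c] True by (simp add: p_def)
    moreover have "pochhammer c (n + k) = pochhammer c n * pochhammer (c + real n) k"
      by (rule pochhammer_product')
    ultimately have "4 ^ k * E k * p = pochhammer c n * pochhammer (c + real n) k"
      by simp
    then have "4 ^ k * E k * p / pochhammer c n = pochhammer (c + real n) k"
      using pn by simp
    then have eq: "4 ^ k * of_real (E k) * of_real p / of_real (pochhammer c n) =
        complex_of_real (pochhammer (c + real n) k)"
      by (simp flip: \<open>4 ^ k * E k * p / pochhammer c n = _\<close>)
    have p: "pochhammer (of_real c + 2 * of_nat k) (n - k) = complex_of_real p"
      unfolding p_def by (simp flip: pochhammer_of_real)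
    define w where "w = 2 * of_real pi * \<i>"
    have "w \<noteq> 0" by (simp add: w_def)
    moreover have "(- 4 * x) ^ k = (- 1) ^ k * 4 ^ k * x ^ k"
      by (simp flip: power_mult_distrib)
    ultimately show ?thesis
      unfolding I_def w_def[symmetric] p pochhammer_of_real eq[symmetric] using True pn
      by (simp add: pochhammer_minus_of_nat mult_ac)
  qed (simp add: I_def pochhammer_of_nat_eq_0_lemma)
  have "poly_P n x \<alpha> \<beta> \<delta>s \<kappa>s =
      (\<Sum>k. pochhammer (- of_nat n) k * pochhammer (of_real (c + real n)) k * D k * x ^ k)"
    unfolding poly_P_def hypergeom_def D_def C_def c_def
    by (simp only: list.map prod_list.Cons pochhammer_of_real of_real_mult) (simp add: mult_ac add_ac)
  moreover have "\<alpha> + \<beta> + 1 = c" "\<alpha> + \<beta> + 2 = c + 1" "- \<alpha> - \<beta> - 1 = - c"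
    by (simp_all add: c_def)
  ultimately show ?thesis
    using sums_unique[OF sums] by (simp only: term_eq H T_def)
qed

theorem corollary2:
  fixes \<rho> :: nat and \<delta>s :: "real list" and \<kappa>s :: "nat list"
  assumes "\<rho> \<ge> 1" and "length \<delta>s = \<rho>" and "length \<kappa>s = \<rho>"
    and "\<forall>\<delta>\<in>set \<delta>s. \<delta> > -1"
  shows "(\<forall>(\<alpha>::real) (x::complex) (n::nat). \<alpha> > -1 \<longrightarrow>
            poly_L n x \<alpha> \<delta>s \<kappa>s =
              fact n / (2 * of_real pi * \<i>) *
              contour_integral (circlepath 0 1)
                (\<lambda>\<zeta>. \<zeta> powi (- int n - 1) * exp \<zeta> *
                   hypergeom (upper_params \<delta>s) (of_real (\<alpha> + 1) # lower_params \<delta>s \<kappa>s) (- x * \<zeta>)))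
       \<and> (\<forall>(\<alpha>::real) (\<beta>::real) (x::complex) (n::nat).
            \<alpha> > -1 \<and> \<beta> > -1 \<and> \<alpha> + \<beta> > -1 \<and> norm x < 1 / 4 \<longrightarrow>
            poly_P n x \<alpha> \<beta> \<delta>s \<kappa>s =
              1 / (2 * of_real pi * \<i>) * (fact n / pochhammer (of_real (\<alpha> + \<beta> + 1)) n) *
              contour_integral (circlepath 0 (1 / 4))
                (\<lambda>\<zeta>. \<zeta> powi (- int n - 1) * (1 - \<zeta>) powr of_real (- \<alpha> - \<beta> - 1) *
                   hypergeom
                     (of_real ((\<alpha> + \<beta> + 1) / 2) # of_real ((\<alpha> + \<beta> + 2) / 2) # upper_params \<delta>s)
                     (of_real (\<alpha> + 1) # lower_params \<delta>s \<kappa>s)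
                     (- (4 * x * \<zeta> / (1 - \<zeta>)\<^sup>2))))"
  by (intro conjI allI impI poly_L_contour_integral poly_P_contour_integral) (use assms in auto)

end
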